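(* Let $T$ be a locally finite rooted tree, $\ell$ a length function and $\chi$ a capacity function on $T$. For all non-negative integers $n\ge m$ with $n<N_{T,\chi}$, $$n!_{(T,\ell,\chi)}\ \ge\ (n-m)!_{(T,\ell,\chi)}+m!_{(T,\ell,\chi)}.$$
   Context: $T$ has root $\mathfrak r$ and edges oriented away from the root; a length function is $\ell:E(T)\to\mathbb R_{+}$ with (strictly) positive values. A leaf is a vertex $v\ne\mathfrak r$ of valence one, or $\mathfrak r$ if $T=\{\mathfrak r\}$; $L(T)$ is the set of leaves. A capacity function is $\chi:L(T)\to\{1,2,\dots\}\cup\{\infty\}$. $\mathrm{br}(v)$ is the number of children of $v$; $v$ is branching if $\mathrm{br}(v)\ge2$; $\mathscr B(T)$ is the set of branching vertices. $\partial T$ is the set of infinite oriented paths from $\mathfrak r$; $\widetilde\partial T$ is the union of $\partial T$ and the set of oriented paths from $\mathfrak r$ to a leaf. For $\rho,\tau\in\widetilde\partial T$ (distinct if both in $\partial T$), $\langle\rho,\tau\rangle$ is the sum of $\ell(e)$ over the common edges. Factorials: choose $\rho_0\in\widetilde\partial T$ arbitrarily; given $\rho_0,\dots,\rho_{n-1}$, choose $\rho_n$ minimizing $\sum_{j<n}\langle\rho,\rho_j\rangle$ among those $\rho\in\widetilde\partial T$ such that either $\rho\in\partial T$ was not chosen before, or $\rho$ ends at a leaf $v$ and was chosen strictly fewer than $\chi(v)$ times before. Then $n!_{(T,\ell,\chi)}:=\sum_{j<n}\langle\rho_n,\rho_j\rangle$. These numbers are independent of the choices, and are defined exactly for $0\le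 n<N_{T,\chi}$, where $$N_{T,\chi}:=1+\sum_{v\in\mathscr B(T)}(\mathrm{br}(v)-1)+\sum_{v\in L(T)}(\chi(v)-1)\in\{1,2,\dots\}\cup\{\infty\}.$$ *)

theory Defs
  imports
    "HOL-Analysis.Infinite_Sum"
    "HOL-Library.Extended_Nat"
    "HOL-Library.Extended_Real"
    "Graph_Theory.Arc_Walk"
begin

text \<open>
  A rooted tree with its edges oriented away from the root, possibly infinite: every vertex is
  reached from the root by exactly one oriented walk. Uniqueness excludes loops, oriented cycles,
  parallel arcs and arcs into the root, so oriented walks in \<open>T\<close> are automatically paths.
\<close>

locale rooted_tree = wf_digraph T for T :: "('v, 'e) pre_digraph" +
  fixes root :: 'v
  assumes root_in_verts: "root \<in> verts T"
    and ex1_awalk_from_root: "v \<in> verts T \<Longrightarrow> \<exists>!p. awalk root p v"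

definition locally_finite_digraph :: "('v, 'e) pre_digraph \<Rightarrow> bool" where
  "locally_finite_digraph T \<longleftrightarrow>
     (\<forall>v\<in>verts T. finite (in_arcs T v) \<and> finite (out_arcs T v))"

definition valence :: "('v, 'e) pre_digraph \<Rightarrow> 'v \<Rightarrow> nat" where
  "valence T v = in_degree T v + out_degree T v"

definition leaves :: "('v, 'e) pre_digraph \<Rightarrow> 'v \<Rightarrow> 'v set" where
  "leaves T r = {v \<in> verts T. (v \<noteq> r \<and> valence T v = 1) \<or> (v = r \<and> verts T = {r})}"

definition br :: "('v, 'e) pre_digraph \<Rightarrow> 'v \<Rightarrow> nat" where
  "br T v = card {w. v \<rightarrow>\<^bsub>T\<^esub> w}"

definition branching_vertices :: "('v, 'e) pre_digraph \<Rightarrow> 'v set" where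
  "branching_vertices T = {v \<in> verts T. br T v \<ge> 2}"

definition length_function :: "('v, 'e) pre_digraph \<Rightarrow> ('e \<Rightarrow> real) \<Rightarrow> bool" where
  "length_function T l \<longleftrightarrow> (\<forall>e\<in>arcs T. l e > 0)"

definition capacity_function :: "('v, 'e) pre_digraph \<Rightarrow> 'v \<Rightarrow> ('v \<Rightarrow> enat) \<Rightarrow> bool" where
  "capacity_function T r \<chi> \<longleftrightarrow> (\<forall>v\<in>leaves T r. \<chi> v \<ge> 1)"

text \<open>
  Paths from the root are given by their arcs. The empty list is the path consisting of the
  root only.
\<close>

datatype 'e end_path = Finite_Path "'e list" | Infinite_Path "nat \<Rightarrow> 'e"

primrec path_arcs :: "'e end_path \<Rightarrow> 'e set" where
  "path_arcs (Finite_Path p) = set p"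
| "path_arcs (Infinite_Path f) = range f"

definition boundary :: "('v, 'e) pre_digraph \<Rightarrow> 'v \<Rightarrow> 'e end_path set" where
  "boundary T r = {Infinite_Path f | f.
     tail T (f 0) = r \<and> (\<forall>i. f i \<in> arcs T \<and> tail T (f (Suc i)) = head T (f i))}"

definition ext_boundary :: "('v, 'e) pre_digraph \<Rightarrow> 'v \<Rightarrow> 'e end_path set" where
  "ext_boundary T r = boundary T r \<union>
     {Finite_Path p | p v. v \<in> leaves T r \<and> pre_digraph.awalk T r p v}"

text \<open>
  For \<open>\<rho> = \<tau>\<close> in \<open>boundary T r\<close> the sum has infinite support and the value is meaningless; the
  definitions below never use it, since an infinite path is chosen at most once.
\<close>

definition pairing :: "('e \<Rightarrow> real) \<Rightarrow> 'e end_path \<Rightarrow> 'e end_path \<Rightarrow> real" where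
  "pairing l \<rho> \<tau> = (\<Sum>e \<in> path_arcs \<rho> \<inter> path_arcs \<tau>. l e)"

text \<open>
  The paths that may be chosen in step \<open>n\<close>, after \<open>\<rho> 0, \<dots>, \<rho> (n - 1)\<close>.
\<close>

definition admissible ::
  "('v, 'e) pre_digraph \<Rightarrow> 'v \<Rightarrow> ('v \<Rightarrow> enat) \<Rightarrow> (nat \<Rightarrow> 'e end_path) \<Rightarrow> nat \<Rightarrow> 'e end_path \<Rightarrow> bool"
  where
  "admissible T r \<chi> \<rho> n \<sigma> \<longleftrightarrow> \<sigma> \<in> ext_boundary T r \<and>
     (case \<sigma> of
        Infinite_Path f \<Rightarrow> \<forall>j<n. \<rho> j \<noteq> \<sigma>
      | Finite_Path p \<Rightarrow> enat (card {j. j < n \<and> \<rho> j = \<sigma>}) < \<chi> (pre_digraph.awlast T r p))"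

text \<open>
  \<open>\<rho> 0, \<dots>, \<rho> n\<close> is a possible outcome of the choices. For \<open>k = 0\<close> the minimized function is the
  zero function, so that the choice of \<open>\<rho> 0\<close> is arbitrary.
\<close>

definition greedy_choice ::
  "('v, 'e) pre_digraph \<Rightarrow> 'v \<Rightarrow> ('e \<Rightarrow> real) \<Rightarrow> ('v \<Rightarrow> enat) \<Rightarrow> nat \<Rightarrow> (nat \<Rightarrow> 'e end_path) \<Rightarrow> bool"
  where
  "greedy_choice T r l \<chi> n \<rho> \<longleftrightarrow>
     (\<forall>k\<le>n. is_arg_min (\<lambda>\<sigma>. \<Sum>j<k. pairing l \<sigma> (\<rho> j)) (admissible T r \<chi> \<rho> k) (\<rho> k))"

text \<open>
  The value determined by all possible choices \<open>\<rho> 0, \<dots>, \<rho> n\<close>. It is specified only if such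
  choices exist and all of them lead to the same value.
\<close>

definition tree_factorial ::
  "('v, 'e) pre_digraph \<Rightarrow> 'v \<Rightarrow> ('e \<Rightarrow> real) \<Rightarrow> ('v \<Rightarrow> enat) \<Rightarrow> nat \<Rightarrow> real" where
  "tree_factorial T r l \<chi> n =
     (THE x. \<exists>\<rho>. greedy_choice T r l \<chi> n \<rho> \<and> x = (\<Sum>j<n. pairing l (\<rho> n) (\<rho> j)))"

text \<open>
  Every family in \<^typ>\<open>enat\<close> is summable, its sum being the supremum of the finite partial sums.
\<close>

lemma summable_on_enat: "(f :: 'i \<Rightarrow> enat) summable_on A"
  by (rule nonneg_summable_on_complete) simp

lemma infsum_enat_eq_SUP:
  "infsum (f :: 'i \<Rightarrow> enat) A = (SUP F\<in>{F. finite F \<and> F \<subseteq> A}. sum f F)"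
  by (rule nonneg_infsum_complete) simp

definition total_capacity :: "('v, 'e) pre_digraph \<Rightarrow> 'v \<Rightarrow> ('v \<Rightarrow> enat) \<Rightarrow> enat" where
  "total_capacity T r \<chi> =
     1 + (\<Sum>\<^sub>\<infinity>v\<in>branching_vertices T. enat (br T v - 1)) + (\<Sum>\<^sub>\<infinity>v\<in>leaves T r. \<chi> v - 1)"

end

theory Submission
  imports Defs "HOL-Library.Multiset"
begin

text \<open>
  The pairing is an ultrametric: of two of the values \<open>\<langle>a, b\<rangle>\<close>, \<open>\<langle>b, c\<rangle>\<close>, \<open>\<langle>a, c\<rangle>\<close> the smaller one
  is at most the third. This implies that for a greedy sequence \<open>\<rho> 0, \<dots>, \<rho> n\<close> no \<open>\<rho> i\<close> has a larger
  total pairing with the others than \<open>\<rho> n\<close>, and that for any \<open>n\<close> paths \<open>\<tau>\<close>, admissible as a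
  configuration or not, some \<open>\<rho> i\<close> occurs more often among the \<open>\<rho>\<close> than among the \<open>\<tau>\<close> and pairs with
  the \<open>\<tau>\<close> at most as much as with the other \<open>\<rho>\<close>, hence at most \<open>n!\<close>. Taking for the \<open>\<tau>\<close> the first
  terms of greedy sequences of lengths \<open>n - m\<close> and \<open>m\<close>, the path \<open>\<rho> i\<close> is still admissible for both, so
  it pairs with them at least \<open>(n - m)!\<close> and \<open>m!\<close>. The case \<open>m = 0\<close> is the independence
  of the choices.
\<close>

section \<open>Two combinatorial lemmas\<close>

text \<open>
  A version of Dickson's lemma: a path better than \<open>\<sigma>\<^sub>0\<close> has some coordinate
  \<open>g j\<close> smaller than that of \<open>\<sigma>\<^sub>0\<close>, which leaves finitely many slices on which
  one coordinate is constant.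
\<close>

lemma sum_monotone_coordinates_attains_min:
  fixes g :: "'i \<Rightarrow> 'a \<Rightarrow> nat" and h :: "'i \<Rightarrow> 'a \<Rightarrow> real"
  assumes "finite J" and "S \<noteq> {}"
    and "\<And>j \<sigma> \<tau>. j \<in> J \<Longrightarrow> \<sigma> \<in> S \<Longrightarrow> \<tau> \<in> S \<Longrightarrow> g j \<sigma> \<le> g j \<tau> \<Longrightarrow> h j \<sigma> \<le> h j \<tau>"
  shows "\<exists>\<sigma>\<in>S. \<forall>\<tau>\<in>S. (\<Sum>j\<in>J. h j \<sigma>) \<le> (\<Sum>j\<in>J. h j \<tau>)"
  using assms
proof (induction "card J" arbitrary: J S)
  case 0
  then show ?case by auto
next
  case (Suc k)
  let ?F = "\<lambda>\<sigma>. \<Sum>j\<in>J. h j \<sigma>"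
  obtain \<sigma>0 where \<sigma>0: "\<sigma>0 \<in> S" using Suc.prems by blast
  define I where "I = (SIGMA j:J. {..<g j \<sigma>0})"
  define P where "P = (\<lambda>(j, d). {\<sigma> \<in> S. g j \<sigma> = d})"
  have finI: "finite I" unfolding I_def using Suc.prems by auto
  have "\<exists>\<sigma>\<in>P i. \<forall>\<tau>\<in>P i. ?F \<sigma> \<le> ?F \<tau>" if i: "i \<in> I" "P i \<noteq> {}" for i
  proof -
    obtain j d where jd: "i = (j, d)" by (cases i)
    have j: "j \<in> J" using i jd by (auto simp: I_def)
    have sub: "P i \<subseteq> S" by (auto simp: P_def jd)
    \<comment> \<open>On the slice \<open>g j\<close> is constant, and by monotonicity in both
      directions so is \<open>h j\<close>. Only the sum over \<open>J - {j}\<close> remains to be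
      minimized.\<close>
    have "\<exists>\<sigma>\<in>P i. \<forall>\<tau>\<in>P i. (\<Sum>j\<in>J - {j}. h j \<sigma>) \<le> (\<Sum>j\<in>J - {j}. h j \<tau>)"
    proof (rule Suc.hyps(1))
      show "k = card (J - {j})" using Suc.hyps(2) j by simp
      show "finite (J - {j})" using Suc.prems by simp
      show "P i \<noteq> {}" by fact
      show "h j' \<sigma> \<le> h j' \<tau>" if "j' \<in> J - {j}" "\<sigma> \<in> P i" "\<tau> \<in> P i" "g j' \<sigma> \<le> g j' \<tau>" for j' \<sigma> \<tau>
        using that sub by (intro Suc.prems(3)) auto
    qed
    then obtain \<sigma> where \<sigma>: "\<sigma> \<in> P i"
      "\<And>\<tau>. \<tau> \<in> P i \<Longrightarrow> (\<Sum>j\<in>J - {j}. h j \<sigma>) \<le> (\<Sum>j\<in>J - {j}. h j \<tau>)" by blast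
    have "?F \<sigma> \<le> ?F \<tau>" if \<tau>: "\<tau> \<in> P i" for \<tau>
    proof -
      have "h j \<sigma> \<le> h j \<tau>"
        using \<sigma>(1) \<tau> j by (intro Suc.prems(3)) (auto simp: P_def jd)
      then show ?thesis
        using \<sigma>(2)[OF \<tau>] Suc.prems(1) j by (simp add: sum.remove[of J j])
    qed
    with \<sigma>(1) show ?thesis by blast
  qed
  then obtain s where s: "\<And>i. i \<in> I \<Longrightarrow> P i \<noteq> {} \<Longrightarrow> s i \<in> P i \<and> (\<forall>\<tau>\<in>P i. ?F (s i) \<le> ?F \<tau>)"
    by metis
  \<comment> \<open>Finitely many candidates suffice: every point of \<open>S\<close> dominates
    \<open>\<sigma>0\<close> in all coordinates of \<open>g\<close> or lies in one of the
    slices.\<close>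
  define C where "C = insert \<sigma>0 (s ` {i \<in> I. P i \<noteq> {}})"
  have C: "finite C" "C \<noteq> {}" unfolding C_def using finI by auto
  have CS: "C \<subseteq> S" unfolding C_def using \<sigma>0 s by (fastforce simp: P_def)
  obtain \<sigma> where \<sigma>: "\<sigma> \<in> C" "\<And>\<tau>. \<tau> \<in> C \<Longrightarrow> ?F \<sigma> \<le> ?F \<tau>"
    using ex_is_arg_min_if_finite[OF C, of ?F] by (auto simp: is_arg_min_linorder)
  have "?F \<sigma> \<le> ?F \<tau>" if \<tau>: "\<tau> \<in> S" for \<tau>
  proof (cases "\<forall>j\<in>J. g j \<sigma>0 \<le> g j \<tau>")
    case True
    then have "?F \<sigma>0 \<le> ?F \<tau>" using \<sigma>0 \<tau> by (intro sum_mono Suc.prems(3)) auto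
    moreover have "?F \<sigma> \<le> ?F \<sigma>0" by (rule \<sigma>(2)) (simp add: C_def)
    ultimately show ?thesis by linarith
  next
    case False
    then obtain j where j: "j \<in> J" "g j \<tau> < g j \<sigma>0" by auto
    define i where "i = (j, g j \<tau>)"
    have i: "i \<in> I" "\<tau> \<in> P i" using j \<tau> by (auto simp: i_def I_def P_def)
    then have "?F (s i) \<le> ?F \<tau>" using s[of i] by auto
    moreover have "?F \<sigma> \<le> ?F (s i)" using i by (intro \<sigma>(2)) (auto simp: C_def)
    ultimately show ?thesis by linarith
  qed
  with \<sigma>(1) CS show ?case by blast
qed

text \<open>
  Remove from \<open>A\<close> the element closest to a given element of \<open>B\<close>: by the ultrametric
  inequality no remaining element of \<open>A\<close> is closer to the latter than to the former.
\<close>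

lemma ultrametric_multiset_exchange:
  fixes p :: "'a \<Rightarrow> 'a \<Rightarrow> real"
  assumes sym: "\<And>a b. p a b = p b a"
    and ultra: "\<And>a b c. a \<in> E \<Longrightarrow> b \<in> E \<Longrightarrow> c \<in> E \<Longrightarrow> a \<noteq> c \<or> \<not> I a \<Longrightarrow> min (p a b) (p b c) \<le> p a c"
    and "set_mset A \<subseteq> E" "set_mset B \<subseteq> E" "size A = Suc (size B)"
    and "\<And>a. I a \<Longrightarrow> count A a \<le> 1"
  shows "\<exists>\<sigma>. \<sigma> \<in># A \<and> count B \<sigma> < count A \<sigma> \<and>
    (\<Sum>\<tau>\<in>#B. p \<sigma> \<tau>) \<le> (\<Sum>\<tau>\<in># A - {#\<sigma>#}. p \<sigma> \<tau>)"
  using assms(3-)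
proof (induction B arbitrary: A)
  case empty
  then obtain a where "A = {#a#}" by (metis One_nat_def size_1_singleton_mset size_empty)
  then show ?case by simp
next
  case (add b B)
  \<comment> \<open>If \<open>b\<close> occurs in \<open>A\<close>, it is \<open>b\<close> itself
    that is removed, so that the counts in \<open>A\<close> and in \<open>B\<close> drop at the same
    element.\<close>
  obtain a where a: "a \<in># A" "b \<in># A \<Longrightarrow> a = b" "b \<notin># A \<Longrightarrow> \<forall>c\<in>#A. p b c \<le> p b a"
  proof (cases "b \<in># A")
    case True
    then show ?thesis using that[of b] by simp
  next
    case False
    have "set_mset A \<noteq> {}" using add.prems by auto
    then obtain a where "is_arg_min (\<lambda>c. - p b c) (\<lambda>c. c \<in># A) a"
      using ex_is_arg_min_if_finite[of "set_mset A" "\<lambda>c. - p b c"] by auto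
    then show ?thesis using that[of a] False by (auto simp: is_arg_min_linorder)
  qed
  define A' where "A' = A - {#a#}"
  have A: "A = add_mset a A'" using a by (simp add: A'_def)
  have "\<exists>\<sigma>. \<sigma> \<in># A' \<and> count B \<sigma> < count A' \<sigma> \<and>
      (\<Sum>\<tau>\<in>#B. p \<sigma> \<tau>) \<le> (\<Sum>\<tau>\<in># A' - {#\<sigma>#}. p \<sigma> \<tau>)"
  proof (rule add.IH)
    show "count A' c \<le> 1" if "I c" for c
      using add.prems(4)[OF that] by (auto simp: A split: if_splits)
  qed (use add.prems A in auto)
  then obtain \<sigma> where \<sigma>: "\<sigma> \<in># A'" "count B \<sigma> < count A' \<sigma>"
    "(\<Sum>\<tau>\<in>#B. p \<sigma> \<tau>) \<le> (\<Sum>\<tau>\<in># A' - {#\<sigma>#}. p \<sigma> \<tau>)" by blast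
  have "p \<sigma> b \<le> p \<sigma> a"
  proof (cases "b \<in># A")
    case True
    then show ?thesis using a by simp
  next
    case False
    \<comment> \<open>If \<open>\<sigma> = a\<close>, then \<open>\<sigma>\<close> remains after one
      copy of it was removed, so it occurs twice in \<open>A\<close> and cannot satisfy
      \<open>I\<close>.\<close>
    have "\<sigma> \<noteq> a \<or> \<not> I \<sigma>"
    proof (rule ccontr)
      assume "\<not> (\<sigma> \<noteq> a \<or> \<not> I \<sigma>)"
      then have "count A \<sigma> \<ge> 2" "I \<sigma>" using \<sigma>(1) by (auto simp: A Suc_le_eq)
      then show False using add.prems(4)[of \<sigma>] by simp
    qed
    then have "min (p \<sigma> b) (p b a) \<le> p \<sigma> a"
      using add.prems A \<sigma>(1) by (intro ultra) auto
    moreover have "p \<sigma> b \<le> p b a" using a(3) False \<sigma>(1) A by (simp add: sym[of \<sigma> b])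
    ultimately show ?thesis by simp
  qed
  moreover have "A - {#\<sigma>#} = add_mset a (A' - {#\<sigma>#})"
    using \<sigma>(1) by (simp add: A multi_union_self_other_eq)
  moreover have "count (add_mset b B) \<sigma> < count A \<sigma>"
    using \<sigma>(1,2) a(2) by (auto simp: A)
  ultimately show ?case using \<sigma> by (intro exI[of _ \<sigma>]) (auto simp: A)
qed

section \<open>Paths from the root\<close>

context rooted_tree
begin

definition root_walk :: "'v \<Rightarrow> 'e list" where
  "root_walk v = (THE p. awalk root p v)"

lemma root_walk_eqI: "awalk root p v \<Longrightarrow> root_walk v = p"
  unfolding root_walk_def using ex1_awalk_from_root[of v] awalk_last_in_verts by blast

lemma awalk_root_walk: "v \<in> verts T \<Longrightarrow> awalk root (root_walk v) v"
  using ex1_awalk_from_root root_walk_eqI by metis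

lemma awalk_root_unique: "awalk root p v \<Longrightarrow> awalk root q v \<Longrightarrow> p = q"
  using root_walk_eqI by metis

lemma awalk_up_to_arc:
  assumes "awalk u (xs @ e # ys) v"
  shows "awalk u (xs @ [e]) (head T e)"
  using assms by (auto simp: awalk_Cons_iff awalk_Nil_iff)

lemma awalk_snocI: "awalk u xs (tail T e) \<Longrightarrow> e \<in> arcs T \<Longrightarrow> awalk u (xs @ [e]) (head T e)"
  by (rule awalk_appendI[of _ _ "tail T e"]) (auto simp: arc_implies_awalk)

lemma infinite_path_awalk:
  assumes "Infinite_Path f \<in> boundary T root"
  shows "awalk root (map f [0..<n]) (tail T (f n))"
proof (induction n)
  case 0
  then show ?case using assms root_in_verts by (auto simp: boundary_def awalk_Nil_iff)
next
  case (Suc n)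
  then show ?case using awalk_snocI[of root "map f [0..<n]" "f n"] assms
    by (auto simp: boundary_def)
qed

lemma infinite_path_root_walk:
  assumes "Infinite_Path f \<in> boundary T root"
  shows "root_walk (head T (f n)) = map f [0..<Suc n]"
proof -
  have "tail T (f (Suc n)) = head T (f n)" using assms by (auto simp: boundary_def)
  then show ?thesis using infinite_path_awalk[OF assms, of "Suc n"] by (metis root_walk_eqI)
qed

lemma path_cases:
  assumes "\<sigma> \<in> ext_boundary T root"
  obtains (Finite) p v where "\<sigma> = Finite_Path p" "v \<in> leaves T root" "awalk root p v"
  | (Infinite) f where "\<sigma> = Infinite_Path f" "Infinite_Path f \<in> boundary T root"
  using assms unfolding ext_boundary_def boundary_def by blast

section \<open>Intersections of paths from the root\<close>

lemma path_root_walk_subset: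
  assumes "\<sigma> \<in> ext_boundary T root" "e \<in> path_arcs \<sigma>"
  shows "set (root_walk (head T e)) \<subseteq> path_arcs \<sigma>"
  using assms(1)
proof (cases rule: path_cases)
  case (Finite p v)
  then obtain xs ys where p: "p = xs @ e # ys" using assms(2) by (auto simp: in_set_conv_decomp)
  then have "root_walk (head T e) = xs @ [e]"
    using Finite awalk_up_to_arc root_walk_eqI by blast
  then show ?thesis using p Finite by auto
next
  case (Infinite f)
  then obtain n where "e = f n" using assms(2) by auto
  then show ?thesis using Infinite by (auto simp: infinite_path_root_walk)
qed

lemma path_arcs_chain:
  assumes "\<sigma> \<in> ext_boundary T root" "e \<in> path_arcs \<sigma>" "f \<in> path_arcs \<sigma>"
  shows "e \<in> set (root_walk (head T f)) \<or> f \<in> set (root_walk (head T e))"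
  using assms(1)
proof (cases rule: path_cases)
  case (Finite p v)
  then obtain xs ys where p: "p = xs @ e # ys" using assms(2) by (auto simp: in_set_conv_decomp)
  then have e: "root_walk (head T e) = xs @ [e]"
    using Finite awalk_up_to_arc root_walk_eqI by blast
  show ?thesis
  proof (cases "f \<in> set ys")
    case True
    then obtain zs ws where "ys = zs @ f # ws" by (auto simp: in_set_conv_decomp)
    then have "root_walk (head T f) = (xs @ e # zs) @ [f]"
      using p Finite awalk_up_to_arc[of root "xs @ e # zs" f ws v] by (intro root_walk_eqI) simp
    then show ?thesis by simp
  next
    case False
    then show ?thesis using e p Finite assms(3) by auto
  qed
next
  case (Infinite g)
  then obtain m n where "e = g m" "f = g n" using assms by auto
  moreover have "m \<in> {0..<Suc n} \<or> n \<in> {0..<Suc m}" by auto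
  ultimately show ?thesis
    unfolding \<open>e = g m\<close> \<open>f = g n\<close> infinite_path_root_walk[OF Infinite(2)] set_map set_upt by blast
qed

text \<open>Both sets are initial segments of \<open>b\<close>: they are closed under passing to
  earlier arcs, and the arcs of \<open>b\<close> form a chain. This is the source of the ultrametric
  inequality.\<close>

lemma path_inter_comparable:
  assumes "a \<in> ext_boundary T root" "b \<in> ext_boundary T root" "c \<in> ext_boundary T root"
  shows "path_arcs b \<inter> path_arcs a \<subseteq> path_arcs c \<or> path_arcs b \<inter> path_arcs c \<subseteq> path_arcs a"
  using assms path_arcs_chain[OF assms(2)] path_root_walk_subset by blast

text \<open>Infinitely many common arcs of two infinite paths reach beyond every position
  \<open>i\<close>. The root walk to the head of such an arc is an initial segment of both paths, so
  they agree at \<open>i\<close>.\<close>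

lemma finite_path_inter:
  assumes a: "a \<in> ext_boundary T root" and b: "b \<in> ext_boundary T root"
    and "a \<noteq> b \<or> (\<exists>p. a = Finite_Path p)"
  shows "finite (path_arcs a \<inter> path_arcs b)"
proof (rule ccontr)
  assume inf: "infinite (path_arcs a \<inter> path_arcs b)"
  then obtain f where f: "a = Infinite_Path f" "Infinite_Path f \<in> boundary T root"
    using path_cases[OF a] by (metis List.finite_set finite_Int path_arcs.simps(1))
  from inf obtain g where g: "b = Infinite_Path g" "Infinite_Path g \<in> boundary T root"
    using path_cases[OF b] by (metis List.finite_set finite_Int path_arcs.simps(1))
  have "f i = g i" for i
  proof -
    have "\<not> path_arcs a \<inter> path_arcs b \<subseteq> f ` {..i}" using inf finite_subset by blast
    then obtain e where "e \<in> range f" "e \<in> range g" "e \<notin> f ` {..i}" using f g by auto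
    then obtain m n where mn: "f m = g n" "f m \<notin> f ` {..i}" by fastforce
    then have i: "i < m" by (meson atMost_iff image_eqI not_le)
    have eq: "map f [0..<Suc m] = map g [0..<Suc n]"
      using infinite_path_root_walk[OF f(2), of m] infinite_path_root_walk[OF g(2), of n] mn by simp
    then have "m = n" by (metis diff_zero length_map length_upt nat.inject)
    with eq i show ?thesis by (auto simp: map_eq_conv)
  qed
  then have "f = g" by auto
  with assms(3) f g show False by simp
qed

section \<open>Leaves and the prolongation of walks\<close>

lemma in_arcs_nonroot:
  assumes "v \<in> verts T" "v \<noteq> root"
  shows "\<exists>e. in_arcs T v = {e}"
proof -
  obtain p where p: "awalk root p v" using assms awalk_root_walk by blast
  have "p \<noteq> []" using p assms by (auto simp: awalk_Nil_iff)
  then obtain xs e where xs: "p = xs @ [e]" by (metis rev_exhaust)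
  have e: "e \<in> in_arcs T v" using p unfolding xs by (auto simp: awalk_simps)
  have "e' = e" if "e' \<in> in_arcs T v" for e'
  proof -
    have e': "e' \<in> arcs T" "head T e' = v" using that by auto
    then have "awalk root (root_walk (tail T e') @ [e']) v"
      using awalk_snocI[OF awalk_root_walk, of e'] by simp
    then show ?thesis using p xs awalk_root_unique by blast
  qed
  with e show ?thesis by blast
qed

lemma leafI_no_out_arcs:
  assumes "v \<in> verts T" "out_arcs T v = {}"
  shows "v \<in> leaves T root"
proof (cases "v = root")
  case True
  have "w = root" if w: "w \<in> verts T" for w
  proof -
    obtain p where p: "awalk root p w" using w awalk_root_walk by blast
    show ?thesis
    proof (cases p)
      case Nil
      then show ?thesis using p by (simp add: awalk_Nil_iff)
    next
      case (Cons e q)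
      then have "e \<in> out_arcs T v" using p True by (simp add: awalk_Cons_iff)
      with assms(2) show ?thesis by blast
    qed
  qed
  then have "verts T = {root}" using root_in_verts by blast
  then show ?thesis using True by (simp add: leaves_def)
next
  case False
  with in_arcs_nonroot[OF assms(1)] obtain e where "in_arcs T v = {e}" by blast
  with False assms show ?thesis
    by (simp add: leaves_def valence_def in_degree_def out_degree_def)
qed

text \<open>From \<open>v\<close> on, always take the arc selected by \<open>P\<close>. This either
  stops at a vertex without outgoing arcs, which is a leaf, or continues forever. The upper bound on
  the arcs serves to tell such paths apart.\<close>

lemma path_along_preferred_arcs:
  assumes pref: "\<And>v. v \<in> verts T \<Longrightarrow> out_arcs T v \<noteq> {} \<Longrightarrow> P v \<in> out_arcs T v"
    and p: "awalk root p v"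
  shows "\<exists>\<sigma>\<in>ext_boundary T root. set p \<subseteq> path_arcs \<sigma> \<and>
    path_arcs \<sigma> \<subseteq> set p \<union> P ` {w \<in> verts T. out_arcs T w \<noteq> {}}"
proof -
  let ?P = "P ` {w \<in> verts T. out_arcs T w \<noteq> {}}"
  define u where "u n = ((\<lambda>w. head T (P w)) ^^ n) v" for n
  have u_0: "u 0 = v" and u_Suc: "\<And>n. u (Suc n) = head T (P (u n))" by (simp_all add: u_def)
  have step: "u n \<in> verts T \<and> awalk root (p @ map (\<lambda>i. P (u i)) [0..<n]) (u n)"
    if "\<And>i. i < n \<Longrightarrow> out_arcs T (u i) \<noteq> {}" for n
    using that
  proof (induction n)
    case 0
    then show ?case using p awalk_last_in_verts by (auto simp: u_0)
  next
    case (Suc n)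
    then have "P (u n) \<in> out_arcs T (u n)" using pref by auto
    then have w: "awalk root ((p @ map (\<lambda>i. P (u i)) [0..<n]) @ [P (u n)]) (u (Suc n))"
      using Suc unfolding u_Suc by (intro awalk_snocI) auto
    then show ?case using awalk_last_in_verts[OF w] by simp
  qed
  show ?thesis
  proof (cases "\<exists>n. out_arcs T (u n) = {}")
    case True
    define n where "n = (LEAST n. out_arcs T (u n) = {})"
    have n: "out_arcs T (u n) = {}" "\<And>i. i < n \<Longrightarrow> out_arcs T (u i) \<noteq> {}"
      using LeastI_ex[OF True] not_less_Least unfolding n_def by blast+
    let ?q = "p @ map (\<lambda>i. P (u i)) [0..<n]"
    have "awalk root ?q (u n)" "u n \<in> leaves T root"
      using step[of n] n leafI_no_out_arcs by auto
    then have "Finite_Path ?q \<in> ext_boundary T root" unfolding ext_boundary_def by blast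
    moreover have "P (u i) \<in> ?P" if "i < n" for i using step[of i] n that by fastforce
    ultimately show ?thesis by (intro bexI[of _ "Finite_Path ?q"]) auto
  next
    case False
    define f where "f i = (if i < length p then p ! i else P (u (i - length p)))" for i
    have f_eq: "map f [0..<length p + n] = p @ map (\<lambda>i. P (u i)) [0..<n]" for n
      by (rule nth_equalityI) (auto simp: f_def nth_append)
    have walk: "awalk root (map f [0..<Suc n]) (head T (f n))" for n
    proof -
      \<comment> \<open>Only prefixes of length at least \<open>length p\<close> are known to be
        walks; this one contains position \<open>n\<close> and can be cut there.\<close>
      have "awalk root (map f [0..<length p + Suc n]) (u (Suc n))"
        unfolding f_eq using step[of "Suc n"] False by blast
      moreover have "[0..<length p + Suc n] = [0..<n] @ n # [Suc n..<length p + Suc n]"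
        using upt_add_eq_append[of 0 n "Suc (length p)"] upt_conv_Cons[of n "n + Suc (length p)"]
        by (simp add: add.commute del: upt_Suc)
      ultimately have "awalk root (map f [0..<n] @ f n # map f [Suc n..<length p + Suc n]) (u (Suc n))"
        by (simp only: map_append list.map)
      then show ?thesis using awalk_up_to_arc[of root "map f [0..<n]" "f n"] by fastforce
    qed
    have arc: "f n \<in> arcs T" for n using walk[of n] by (auto simp: awalk_def)
    have "tail T (f 0) = root" using walk[of 0] by (auto simp: awalk_simps)
    moreover have "tail T (f (Suc n)) = head T (f n)" for n
    proof -
      have "awalk root (map f [0..<Suc n] @ [f (Suc n)]) (head T (f (Suc n)))"
        using walk[of "Suc n"] by simp
      then show ?thesis
        using walk[of n] awlast_of_awalk unfolding awalk_append_iff by (auto simp: awalk_simps)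
    qed
    ultimately have "Infinite_Path f \<in> ext_boundary T root"
      using arc by (auto simp: ext_boundary_def boundary_def)
    moreover have "set p \<subseteq> range f"
      by (auto simp: in_set_conv_nth f_def image_iff)
    moreover have "range f \<subseteq> set p \<union> ?P"
      using step False by (auto simp: f_def)
    ultimately show ?thesis by (intro bexI[of _ "Infinite_Path f"]) auto
  qed
qed

lemma root_walk_arc:
  assumes "e \<in> arcs T"
  obtains q where "awalk root (q @ [e]) (head T e)" "root_walk (head T e) = q @ [e]"
proof -
  obtain q where "awalk root q (tail T e)" using assms awalk_root_walk[of "tail T e"] by auto
  then have "awalk root (q @ [e]) (head T e)" using assms awalk_snocI by blast
  then show ?thesis using that root_walk_eqI by blast
qed

text \<open>The root walk to the head of an earlier arc is a proper initial segment, hence strictly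
  shorter.\<close>

lemma root_walk_antisym:
  assumes "e \<in> arcs T" "f \<in> arcs T"
    and "e \<in> set (root_walk (head T f))" "f \<in> set (root_walk (head T e))"
  shows "e = f"
proof -
  have *: "length (root_walk (head T a)) < length (root_walk (head T b))"
    if ab: "b \<in> arcs T" "a \<in> set (root_walk (head T b))" "a \<noteq> b" for a b
  proof -
    obtain q where q: "awalk root (q @ [b]) (head T b)" "root_walk (head T b) = q @ [b]"
      using root_walk_arc[OF ab(1)] by blast
    then obtain xs ys where "q = xs @ a # ys"
      using ab by (auto simp: in_set_conv_decomp)
    moreover from this have "root_walk (head T a) = xs @ [a]"
      using q awalk_up_to_arc[of root xs a "ys @ [b]" "head T b"]
      by (intro root_walk_eqI) (simp del: awalk_append_iff)
    ultimately show ?thesis using q by simp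
  qed
  show ?thesis
  proof (rule ccontr)
    assume "e \<noteq> f"
    then show False using *[OF assms(2,3)] *[OF assms(1,4)] by (metis less_asym)
  qed
qed

end

section \<open>Greedy sequences of paths\<close>

locale weighted_tree = rooted_tree T root
  for T :: "('v, 'e) pre_digraph" and root :: 'v +
  fixes l :: "'e \<Rightarrow> real" and \<chi> :: "'v \<Rightarrow> enat"
  assumes locally_finite: "locally_finite_digraph T"
    and length_function: "length_function T l"
    and capacity_function: "capacity_function T root \<chi>"
begin

abbreviation ends :: "'e end_path set" where
  "ends \<equiv> ext_boundary T root"

text \<open>Capacity 1 for infinite paths turns the two cases of \<open>admissible\<close> into a
  single bound on the number of earlier choices.\<close>

definition path_capacity :: "'e end_path \<Rightarrow> enat" where
  "path_capacity \<sigma> = (case \<sigma> of Finite_Path p \<Rightarrow> \<chi> (awlast root p) | Infinite_Path f \<Rightarrow> 1)"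

section \<open>The pairing as an ultrametric\<close>

lemma path_arcs_subset: "\<sigma> \<in> ends \<Longrightarrow> path_arcs \<sigma> \<subseteq> arcs T"
  by (erule path_cases) (auto simp: awalk_def boundary_def)

lemma pairing_commute: "pairing l a b = pairing l b a"
  by (simp add: pairing_def Int_commute)

text \<open>Lengths are positive. Finiteness of the larger set matters because a sum over an
  infinite set is 0 by default.\<close>

lemma pairing_mono:
  assumes "c \<in> ends" "finite (path_arcs c \<inter> path_arcs d)"
    and "path_arcs a \<inter> path_arcs b \<subseteq> path_arcs c \<inter> path_arcs d"
  shows "pairing l a b \<le> pairing l c d"
  unfolding pairing_def using assms path_arcs_subset[OF assms(1)] length_function
  by (intro sum_mono2) (auto simp: length_function_def intro: less_imp_le)

text \<open>The arcs that \<open>b\<close> shares with \<open>a\<close> and those that it shares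
  with \<open>c\<close> are nested sets, and the smaller one consists of arcs common to
  \<open>a\<close> and \<open>c\<close>. The last assumption makes the latter finite in
  number.\<close>

lemma pairing_ultrametric:
  assumes "a \<in> ends" "b \<in> ends" "c \<in> ends" "a \<noteq> c \<or> \<not> (\<exists>f. a = Infinite_Path f)"
  shows "min (pairing l a b) (pairing l b c) \<le> pairing l a c"
proof -
  have fin: "finite (path_arcs a \<inter> path_arcs c)"
    using assms by (intro finite_path_inter) (auto intro: end_path.exhaust)
  have "path_arcs a \<inter> path_arcs b \<subseteq> path_arcs a \<inter> path_arcs c \<or>
      path_arcs b \<inter> path_arcs c \<subseteq> path_arcs a \<inter> path_arcs c"
    using path_inter_comparable[OF assms(1-3)] by blast
  then show ?thesis using pairing_mono[OF assms(1) fin] by (auto simp: min_le_iff_disj)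
qed

section \<open>Admissible and greedy choices\<close>

lemma admissible_iff:
  "admissible T root \<chi> \<rho> n \<sigma> \<longleftrightarrow>
    \<sigma> \<in> ends \<and> enat (card {j. j < n \<and> \<rho> j = \<sigma>}) < path_capacity \<sigma>"
  by (cases \<sigma>) (auto simp: admissible_def path_capacity_def one_enat_def)

lemma path_capacity_ge_1: "\<sigma> \<in> ends \<Longrightarrow> 1 \<le> path_capacity \<sigma>"
  by (erule path_cases) (use capacity_function in \<open>auto simp: path_capacity_def capacity_function_def\<close>)

lemma admissible_antimono:
  assumes "admissible T root \<chi> \<rho> n \<sigma>" "k \<le> n"
  shows "admissible T root \<chi> \<rho> k \<sigma>"
proof -
  have "card {j. j < k \<and> \<rho> j = \<sigma>} \<le> card {j. j < n \<and> \<rho> j = \<sigma>}"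
    using assms(2) by (intro card_mono) auto
  then show ?thesis using assms(1) unfolding admissible_iff
    by (meson enat_ord_simps(1) order_le_less_trans)
qed

lemma greedy_choice_admissible:
  "greedy_choice T root l \<chi> n \<rho> \<Longrightarrow> k \<le> n \<Longrightarrow> admissible T root \<chi> \<rho> k (\<rho> k)"
  by (auto simp: greedy_choice_def is_arg_min_def)

lemma greedy_choice_in_ends: "greedy_choice T root l \<chi> n \<rho> \<Longrightarrow> k \<le> n \<Longrightarrow> \<rho> k \<in> ends"
  using greedy_choice_admissible admissible_iff by blast

lemma greedy_choice_le:
  "greedy_choice T root l \<chi> n \<rho> \<Longrightarrow> k \<le> n \<Longrightarrow> admissible T root \<chi> \<rho> k \<sigma> \<Longrightarrow>
    (\<Sum>j<k. pairing l (\<rho> k) (\<rho> j)) \<le> (\<Sum>j<k. pairing l \<sigma> (\<rho> j))"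
  by (auto simp: greedy_choice_def is_arg_min_linorder)

lemma greedy_choice_mono: "greedy_choice T root l \<chi> n \<rho> \<Longrightarrow> k \<le> n \<Longrightarrow> greedy_choice T root l \<chi> k \<rho>"
  by (auto simp: greedy_choice_def)

lemma greedy_choice_infinite_distinct:
  assumes g: "greedy_choice T root l \<chi> n \<rho>" and "i \<le> n" "j \<le> n" "i \<noteq> j" "\<rho> i = Infinite_Path f"
  shows "\<rho> i \<noteq> \<rho> j"
  using assms(2-)
proof (induction i j rule: linorder_wlog)
  case (le i j)
  then show ?case using greedy_choice_admissible[OF g, of j]
    by (cases "\<rho> j") (auto simp: admissible_def)
next
  case (sym j i)
  then show ?case by auto
qed

lemma greedy_choice_count:
  assumes "greedy_choice T root l \<chi> n \<rho>" "k \<le> Suc n"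
  shows "enat (card {j. j < k \<and> \<rho> j = \<sigma>}) \<le> path_capacity \<sigma>"
  using assms(2)
proof (induction k)
  case (Suc k)
  show ?case
  proof (cases "\<rho> k = \<sigma>")
    case True
    then have "{j. j < Suc k \<and> \<rho> j = \<sigma>} = insert k {j. j < k \<and> \<rho> j = \<sigma>}" by auto
    then show ?thesis
      using greedy_choice_admissible[OF assms(1), of k] Suc.prems True
      by (auto simp: admissible_iff ileI1 eSuc_enat[symmetric])
  next
    case False
    then have "{j. j < Suc k \<and> \<rho> j = \<sigma>} = {j. j < k \<and> \<rho> j = \<sigma>}" using less_Suc_eq by auto
    then show ?thesis using Suc by simp
  qed
qed (simp add: enat_0)

text \<open>
  Let \<open>k\<close> be the last index before \<open>n\<close> of a path that shares more with \<open>\<rho> i\<close> than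
  \<open>\<rho> n\<close> does. Since \<open>\<rho> n\<close> was available in step \<open>k\<close>, the claim for \<open>k\<close> and the minimality
  of \<open>\<rho> k\<close> compare \<open>\<rho> i\<close> with \<open>\<rho> n\<close> on the paths before \<open>k\<close>; after \<open>k\<close> the ultrametric
  inequality does.
\<close>

lemma greedy_choice_last_max:
  assumes "greedy_choice T root l \<chi> n \<rho>" "i \<le> n"
  shows "(\<Sum>j\<in>{..n} - {i}. pairing l (\<rho> i) (\<rho> j)) \<le> (\<Sum>j<n. pairing l (\<rho> n) (\<rho> j))"
  using assms
proof (induction n rule: less_induct)
  case (less n)
  let ?p = "\<lambda>a b. pairing l (\<rho> a) (\<rho> b)"
  note g = less.prems(1)
  have ultra: "min (?p a b) (?p b c) \<le> ?p a c" if "a \<le> n" "b \<le> n" "c \<le> n" "a \<noteq> c" for a b c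
    using that greedy_choice_in_ends[OF g] greedy_choice_infinite_distinct[OF g, of a c]
    by (intro pairing_ultrametric) auto
  show ?case
  proof (cases "i = n")
    case True
    have "{..n} - {n} = {..<n}" by auto
    then show ?thesis using True by simp
  next
    case False
    then have i: "i < n" using less.prems by simp
    \<comment> \<open>\<open>i\<close> is included so that \<open>k\<close> always exists; for
      \<open>k = i\<close> the comparison at \<open>k\<close> is the symmetry of the
      pairing.\<close>
    define K where "K = {j. i \<le> j \<and> j < n \<and> (j = i \<or> ?p i n < ?p i j)}"
    have K: "finite K" "i \<in> K" using i by (auto simp: K_def)
    define k where "k = Max K"
    have "k \<in> K" unfolding k_def using K by (intro Max_in) auto
    then have k: "i \<le> k" "k < n" "k = i \<or> ?p i n < ?p i k" by (auto simp: K_def)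
    have after: "?p i j \<le> ?p i n" if "k < j" "j < n" for j
    proof -
      have "j \<notin> K" using that K(1) Max_ge[of K j] unfolding k_def by linarith
      then show ?thesis using that k by (auto simp: K_def)
    qed
    \<comment> \<open>The sum for \<open>i\<close> has a term at \<open>n\<close>, the sum for
      \<open>n\<close> has one at \<open>k\<close> that is otherwise unmatched; these two are
      compared with each other.\<close>
    have "?p i n \<le> ?p n k"
    proof (cases "k = i")
      case True
      then show ?thesis by (simp add: pairing_commute)
    next
      case False
      then have "min (?p n i) (?p i k) \<le> ?p n k" using k i by (intro ultra) auto
      then show ?thesis using k False by (auto simp: pairing_commute[of "\<rho> n"])
    qed
    moreover have "(\<Sum>j\<in>{k<..<n}. ?p i j) \<le> (\<Sum>j\<in>{k<..<n}. ?p n j)"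
    proof (rule sum_mono)
      fix j assume "j \<in> {k<..<n}"
      then have j: "k < j" "j < n" by auto
      then have "min (?p n i) (?p i j) \<le> ?p n j" using i by (intro ultra) auto
      then show "?p i j \<le> ?p n j" using after[OF j] by (simp add: pairing_commute[of "\<rho> n"])
    qed
    moreover have "(\<Sum>j\<in>{..k} - {i}. ?p i j) \<le> (\<Sum>j<k. ?p n j)"
    proof -
      have "(\<Sum>j\<in>{..k} - {i}. ?p i j) \<le> (\<Sum>j<k. ?p k j)"
        using less.IH[of k] k greedy_choice_mono[OF g, of k] by simp
      also have "\<dots> \<le> (\<Sum>j<k. ?p n j)"
        using k by (intro greedy_choice_le[OF g] admissible_antimono[OF greedy_choice_admissible[OF g]]) auto
      finally show ?thesis .
    qed
    moreover have "{..n} - {i} = ({..k} - {i}) \<union> {k<..<n} \<union> {n}" "{..<n} = {..<k} \<union> {k<..<n} \<union> {k}"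
      using k i by auto
    moreover have "(\<Sum>j\<in>({..k} - {i}) \<union> {k<..<n} \<union> {n}. ?p i j) =
        (\<Sum>j\<in>{..k} - {i}. ?p i j) + (\<Sum>j\<in>{k<..<n}. ?p i j) + ?p i n"
      using k by (subst sum.union_disjoint; auto)+
    moreover have "(\<Sum>j\<in>{..<k} \<union> {k<..<n} \<union> {k}. ?p n j) =
        (\<Sum>j<k. ?p n j) + (\<Sum>j\<in>{k<..<n}. ?p n j) + ?p n k"
      by (subst sum.union_disjoint; auto)+
    ultimately show ?thesis by simp
  qed
qed

section \<open>Superadditivity and independence of the choices\<close>

lemma exists_cheap_path:
  assumes g: "greedy_choice T root l \<chi> n \<rho>" and B: "set_mset B \<subseteq> ends" "size B = n"
  shows "\<exists>\<sigma>\<in>ends. enat (count B \<sigma>) < path_capacity \<sigma> \<and>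
    (\<Sum>\<tau>\<in>#B. pairing l \<sigma> \<tau>) \<le> (\<Sum>j<n. pairing l (\<rho> n) (\<rho> j))"
proof -
  define A where "A = image_mset \<rho> (mset_set {..n})"
  have cnt: "count A \<sigma> = card {j. j < Suc n \<and> \<rho> j = \<sigma>}" for \<sigma>
  proof -
    have "\<rho> -` {\<sigma>} \<inter> {..n} = {j. j < Suc n \<and> \<rho> j = \<sigma>}" by auto
    then show ?thesis by (simp add: A_def count_image_mset)
  qed
  have cap: "enat (count A \<sigma>) \<le> path_capacity \<sigma>" for \<sigma>
    unfolding cnt by (rule greedy_choice_count[OF g]) simp
  have "\<exists>\<sigma>. \<sigma> \<in># A \<and> count B \<sigma> < count A \<sigma> \<and>
    (\<Sum>\<tau>\<in>#B. pairing l \<sigma> \<tau>) \<le> (\<Sum>\<tau>\<in># A - {#\<sigma>#}. pairing l \<sigma> \<tau>)"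
  proof (rule ultrametric_multiset_exchange[of "pairing l" ends "\<lambda>\<sigma>. \<exists>f. \<sigma> = Infinite_Path f"])
    show "count A \<sigma> \<le> 1" if "\<exists>f. \<sigma> = Infinite_Path f" for \<sigma>
      using cap[of \<sigma>] that by (auto simp: path_capacity_def one_enat_def)
    show "set_mset A \<subseteq> ends" using greedy_choice_in_ends[OF g] by (auto simp: A_def)
    show "size A = Suc (size B)" by (simp add: A_def B)
  qed (use B pairing_commute pairing_ultrametric in auto)
  then obtain i where i: "i \<le> n" "count B (\<rho> i) < count A (\<rho> i)"
    "(\<Sum>\<tau>\<in>#B. pairing l (\<rho> i) \<tau>) \<le> (\<Sum>\<tau>\<in># A - {#\<rho> i#}. pairing l (\<rho> i) \<tau>)"
    by (auto simp: A_def)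
  have "A - {#\<rho> i#} = image_mset \<rho> (mset_set ({..n} - {i}))"
    using i(1) by (simp add: A_def mset_set_Diff image_mset_Diff)
  then have "(\<Sum>\<tau>\<in># A - {#\<rho> i#}. pairing l (\<rho> i) \<tau>) = (\<Sum>j\<in>{..n} - {i}. pairing l (\<rho> i) (\<rho> j))"
    by (simp add: sum_unfold_sum_mset image_mset.compositionality o_def)
  \<comment> \<open>\<open>A\<close> respects the capacities, so a path with fewer copies in
    \<open>B\<close> than in \<open>A\<close> has free capacity relative to
    \<open>B\<close>.\<close>
  moreover have "enat (count B (\<rho> i)) < path_capacity (\<rho> i)"
    using i(2) cap[of "\<rho> i"] by (meson enat_ord_simps(2) order_less_le_trans)
  ultimately show ?thesis
    using i greedy_choice_in_ends[OF g] greedy_choice_last_max[OF g i(1)]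
    by (intro bexI[of _ "\<rho> i"]) auto
qed

lemma greedy_choice_superadditive:
  assumes "greedy_choice T root l \<chi> (p + q) \<rho>"
    and \<alpha>: "greedy_choice T root l \<chi> p \<alpha>" and \<beta>: "greedy_choice T root l \<chi> q \<beta>"
  shows "(\<Sum>j<p. pairing l (\<alpha> p) (\<alpha> j)) + (\<Sum>j<q. pairing l (\<beta> q) (\<beta> j))
    \<le> (\<Sum>j<p + q. pairing l (\<rho> (p + q)) (\<rho> j))"
proof -
  define M where "M f k = image_mset f (mset_set {..<k})" for f :: "nat \<Rightarrow> 'e end_path" and k :: nat
  have cnt: "count (M f k) \<sigma> = card {j. j < k \<and> f j = \<sigma>}" for f k \<sigma>
  proof -
    have "f -` {\<sigma>} \<inter> {..<k} = {j. j < k \<and> f j = \<sigma>}" by auto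
    then show ?thesis by (simp add: M_def count_image_mset)
  qed
  have sum: "(\<Sum>\<tau>\<in>#M f k. pairing l \<sigma> \<tau>) = (\<Sum>j<k. pairing l \<sigma> (f j))" for f k \<sigma>
    by (simp add: M_def sum_unfold_sum_mset image_mset.compositionality o_def)
  have "set_mset (M \<alpha> p + M \<beta> q) \<subseteq> ends" "size (M \<alpha> p + M \<beta> q) = p + q"
    using greedy_choice_in_ends[OF \<alpha>] greedy_choice_in_ends[OF \<beta>] by (auto simp: M_def)
  then obtain \<sigma> where \<sigma>: "\<sigma> \<in> ends" "enat (count (M \<alpha> p + M \<beta> q) \<sigma>) < path_capacity \<sigma>"
    "(\<Sum>\<tau>\<in>#M \<alpha> p + M \<beta> q. pairing l \<sigma> \<tau>) \<le> (\<Sum>j<p + q. pairing l (\<rho> (p + q)) (\<rho> j))"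
    using exists_cheap_path[OF assms(1)] by blast
  \<comment> \<open>Free capacity relative to the sum of the multisets is free capacity relative to
    each, so \<open>\<sigma>\<close> competes with both \<open>\<alpha> p\<close> and
    \<open>\<beta> q\<close>.\<close>
  have "enat (count (M \<alpha> p) \<sigma>) < path_capacity \<sigma>" "enat (count (M \<beta> q) \<sigma>) < path_capacity \<sigma>"
    using \<sigma>(2) by (auto elim: le_less_trans[rotated])
  then have "admissible T root \<chi> \<alpha> p \<sigma>" "admissible T root \<chi> \<beta> q \<sigma>"
    using \<sigma>(1) by (auto simp: admissible_iff cnt)
  then show ?thesis
    using greedy_choice_le[OF \<alpha>, of p \<sigma>] greedy_choice_le[OF \<beta>, of q \<sigma>] \<sigma>(3) by (simp add: sum)
qed

lemma tree_factorial_eq: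
  assumes "greedy_choice T root l \<chi> n \<rho>"
  shows "tree_factorial T root l \<chi> n = (\<Sum>j<n. pairing l (\<rho> n) (\<rho> j))"
proof -
  \<comment> \<open>For \<open>q = 0\<close> the third sequence contributes an empty sum, and
    \<open>\<alpha>\<close> itself can take its place. Exchanging \<open>\<alpha>\<close> and
    \<open>\<beta>\<close> gives equality.\<close>
  have le: "(\<Sum>j<n. pairing l (\<alpha> n) (\<alpha> j)) \<le> (\<Sum>j<n. pairing l (\<beta> n) (\<beta> j))"
    if "greedy_choice T root l \<chi> n \<alpha>" "greedy_choice T root l \<chi> n \<beta>" for \<alpha> \<beta>
    using greedy_choice_superadditive[of n 0 \<beta> \<alpha> \<alpha>] that greedy_choice_mono[of n \<alpha> 0] by simp
  show ?thesis unfolding tree_factorial_def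
    by (rule the_equality) (use assms le in \<open>auto intro: antisym\<close>)
qed

section \<open>Existence of greedy sequences\<close>

text \<open>
  Follow each arc that is not preferred, and the empty walk, by preferred arcs only. The resulting
  paths are distinct, because the last arc that is not preferred can be read off.
\<close>

lemma sum_br_less_card_ends:
  assumes E: "finite ends" and F: "finite F" "F \<subseteq> verts T"
  shows "(\<Sum>v\<in>F. br T v - 1) < card ends"
proof -
  define P where "P v = (SOME e. e \<in> out_arcs T v)" for v
  have P: "P v \<in> out_arcs T v" if "out_arcs T v \<noteq> {}" for v
    unfolding P_def using that by (simp add: some_in_eq del: in_out_arcs_conv)
  let ?P = "P ` {w \<in> verts T. out_arcs T w \<noteq> {}}"
  \<comment> \<open>At least \<open>br T v - 1\<close> arcs at \<open>v\<close> are not preferred,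
    and those at different vertices differ by their tails.\<close>
  define N where "N v = out_arcs T v - {P v}" for v
  define U where "U = (\<Union>v\<in>F. N v)"
  have fin: "finite (out_arcs T v)" if "v \<in> F" for v
    using locally_finite F that by (auto simp: locally_finite_digraph_def)
  have finU: "finite U" unfolding U_def N_def using F fin by auto
  have U_arcs: "U \<subseteq> arcs T" by (auto simp: U_def N_def)
  have U_P: "e \<notin> ?P" if "e \<in> U" for e
  proof
    assume "e \<in> ?P"
    then obtain w where w: "e = P w" "out_arcs T w \<noteq> {}" by blast
    then have "tail T e = w" using P[of w] by simp
    then show False using that w by (auto simp: U_def N_def)
  qed
  have "br T v - 1 \<le> card (N v)" if v: "v \<in> F" for v
  proof -
    have "{w. v \<rightarrow>\<^bsub>T\<^esub> w} = head T ` out_arcs T v"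
      by (auto simp: arcs_ends_def arc_to_ends_def)
    then have "br T v \<le> card (out_arcs T v)"
      unfolding br_def using card_image_le[OF fin[OF v]] by simp
    moreover have "card (out_arcs T v) - 1 \<le> card (N v)"
      unfolding N_def using fin[OF v] by (simp add: card_Diff_singleton_if)
    ultimately show ?thesis by simp
  qed
  then have "(\<Sum>v\<in>F. br T v - 1) \<le> (\<Sum>v\<in>F. card (N v))" by (rule sum_mono)
  also have "\<dots> = card U"
    unfolding U_def using F fin by (intro card_UN_disjoint[symmetric]) (auto simp: N_def)
  also have "card U < card ends"
  proof -
    have "\<exists>\<sigma>\<in>ends. set p \<subseteq> path_arcs \<sigma> \<and> path_arcs \<sigma> \<subseteq> set p \<union> ?P"
      if "awalk root p v" for p v
      using P that by (rule path_along_preferred_arcs)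
    then have "\<forall>v\<in>verts T. \<exists>\<sigma>. \<sigma> \<in> ends \<and> set (root_walk v) \<subseteq> path_arcs \<sigma> \<and>
        path_arcs \<sigma> \<subseteq> set (root_walk v) \<union> ?P"
      using awalk_root_walk by blast
    from bchoice[OF this] obtain \<sigma> where \<sigma>: "\<And>v. v \<in> verts T \<Longrightarrow> \<sigma> v \<in> ends \<and>
        set (root_walk v) \<subseteq> path_arcs (\<sigma> v) \<and> path_arcs (\<sigma> v) \<subseteq> set (root_walk v) \<union> ?P"
      by blast
    have mem: "e \<in> path_arcs (\<sigma> (head T e))" if "e \<in> arcs T" for e
    proof -
      have "e \<in> set (root_walk (head T e))" using root_walk_arc[OF that] by fastforce
      then show ?thesis using \<sigma>[of "head T e"] that by auto
    qed
    have "inj_on (\<lambda>e. \<sigma> (head T e)) U"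
    proof (rule inj_onI)
      fix e f assume ef: "e \<in> U" "f \<in> U" "\<sigma> (head T e) = \<sigma> (head T f)"
      then have arcs: "e \<in> arcs T" "f \<in> arcs T" using U_arcs by auto
      then have "e \<in> path_arcs (\<sigma> (head T f))" "f \<in> path_arcs (\<sigma> (head T e))"
        using mem[of e] mem[of f] ef by auto
      \<comment> \<open>Outside the root walk a constructed path has only preferred arcs, and
        neither \<open>e\<close> nor \<open>f\<close> is preferred.\<close>
      then have "e \<in> set (root_walk (head T f))" "f \<in> set (root_walk (head T e))"
        using \<sigma>[OF head_in_verts[OF arcs(1)]] \<sigma>[OF head_in_verts[OF arcs(2)]]
          U_P[OF ef(1)] U_P[OF ef(2)] by blast+
      then show "e = f" using arcs root_walk_antisym by blast
    qed
    \<comment> \<open>This additional path, made of preferred arcs only, yields the strict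
      inequality.\<close>
    moreover have "\<sigma> root \<notin> (\<lambda>e. \<sigma> (head T e)) ` U"
    proof
      assume "\<sigma> root \<in> (\<lambda>e. \<sigma> (head T e)) ` U"
      then obtain e where e: "e \<in> U" "\<sigma> root = \<sigma> (head T e)" by blast
      then have "e \<in> path_arcs (\<sigma> root)" using mem U_arcs by auto
      moreover have "root_walk root = []"
        using root_in_verts by (intro root_walk_eqI) (simp add: awalk_Nil_iff)
      ultimately show False using \<sigma>[OF root_in_verts] U_P[OF e(1)] by auto
    qed
    ultimately have "Suc (card U) = card (insert (\<sigma> root) ((\<lambda>e. \<sigma> (head T e)) ` U))"
      using finU by (simp add: card_image)
    also have "\<dots> \<le> card ends"
      using \<sigma> root_in_verts U_arcs by (intro card_mono E) auto
    finally show ?thesis by simp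
  qed
  finally show ?thesis .
qed

text \<open>If no path were admissible, each would have been chosen up to its capacity; then
  \<open>ends\<close> is finite and the capacities sum to at most \<open>n\<close>. But this sum is
  at least the total capacity: the branching terms contribute at most \<open>card ends - 1\<close>,
  the leaf terms at most the sum of \<open>path_capacity \<sigma> - 1\<close>.\<close>

lemma exists_admissible:
  assumes "enat n < total_capacity T root \<chi>"
  shows "\<exists>\<sigma>. admissible T root \<chi> \<rho> n \<sigma>"
proof (rule ccontr)
  assume none: "\<not> (\<exists>\<sigma>. admissible T root \<chi> \<rho> n \<sigma>)"
  define J where "J \<sigma> = {j. j < n \<and> \<rho> j = \<sigma>}" for \<sigma>
  have full: "path_capacity \<sigma> \<le> enat (card (J \<sigma>))" if "\<sigma> \<in> ends" for \<sigma>
    using none that by (auto simp: admissible_iff J_def not_less)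
  have J_ne: "J \<sigma> \<noteq> {}" if "\<sigma> \<in> ends" for \<sigma>
    using order_trans[OF path_capacity_ge_1 full, OF that that] by (auto simp: one_enat_def)
  have "ends \<subseteq> \<rho> ` {..<n}"
  proof
    fix \<sigma> assume "\<sigma> \<in> ends"
    then obtain j where "j \<in> J \<sigma>" using J_ne by blast
    then show "\<sigma> \<in> \<rho> ` {..<n}" by (auto simp: J_def)
  qed
  then have E: "finite ends" using finite_subset by blast
  have "(\<Sum>\<sigma>\<in>ends. path_capacity \<sigma>) \<le> (\<Sum>\<sigma>\<in>ends. enat (card (J \<sigma>)))"
    by (rule sum_mono) (rule full)
  also have "\<dots> = enat (\<Sum>\<sigma>\<in>ends. card (J \<sigma>))" by (simp add: of_nat_sum flip: of_nat_eq_enat)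
  also have "(\<Sum>\<sigma>\<in>ends. card (J \<sigma>)) = card (\<Union>\<sigma>\<in>ends. J \<sigma>)"
    using E by (intro card_UN_disjoint[symmetric]) (auto simp: J_def)
  also have "card (\<Union>\<sigma>\<in>ends. J \<sigma>) \<le> card {..<n}" by (intro card_mono) (auto simp: J_def)
  finally have cap: "(\<Sum>\<sigma>\<in>ends. path_capacity \<sigma>) \<le> enat n" by simp
  let ?L = "leaves T root" and ?f = "\<lambda>v. Finite_Path (root_walk v)"
  have leaf: "awalk root (root_walk v) v" if "v \<in> ?L" for v
    using that awalk_root_walk by (auto simp: leaves_def)
  have leaf_end: "?f v \<in> ends" if "v \<in> ?L" for v
    using leaf[OF that] that by (auto simp: ext_boundary_def)
  have leaf_cap: "path_capacity (?f v) = \<chi> v" if "v \<in> ?L" for v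
    using leaf[OF that] by (simp add: path_capacity_def)
  have inj: "inj_on ?f ?L"
  proof (rule inj_onI)
    fix v w assume "v \<in> ?L" "w \<in> ?L" "?f v = ?f w"
    then have "awalk root (root_walk v) v" "awalk root (root_walk v) w" using leaf[of v] leaf[of w] by auto
    then show "v = w" using awalk_ends by blast
  qed
  have finL: "finite ?L"
    using inj_on_finite[OF inj _ E] leaf_end by blast
  have "(\<Sum>\<^sub>\<infinity>v\<in>?L. \<chi> v - 1) = (\<Sum>v\<in>?L. path_capacity (?f v) - 1)"
    using finL leaf_cap by simp
  also have "\<dots> = (\<Sum>\<sigma>\<in>?f ` ?L. path_capacity \<sigma> - 1)" by (simp add: sum.reindex[OF inj])
  also have "\<dots> \<le> (\<Sum>\<sigma>\<in>ends. path_capacity \<sigma> - 1)" using E leaf_end by (intro sum_mono2) auto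
  finally have L: "(\<Sum>\<^sub>\<infinity>v\<in>?L. \<chi> v - 1) \<le> (\<Sum>\<sigma>\<in>ends. path_capacity \<sigma> - 1)" .
  \<comment> \<open>The empty set of vertices shows that \<open>ends\<close> is nonempty, as the
    truncated subtraction in \<open>card ends - 1\<close> requires.\<close>
  have "0 < card ends" using sum_br_less_card_ends[OF E, of "{}"] by simp
  have "(\<Sum>\<^sub>\<infinity>v\<in>branching_vertices T. enat (br T v - 1)) \<le> enat (card ends - 1)"
    unfolding infsum_enat_eq_SUP
  proof (rule SUP_least)
    fix F assume "F \<in> {F. finite F \<and> F \<subseteq> branching_vertices T}"
    then have "(\<Sum>v\<in>F. br T v - 1) < card ends"
      by (intro sum_br_less_card_ends E) (auto simp: branching_vertices_def)
    then show "(\<Sum>v\<in>F. enat (br T v - 1)) \<le> enat (card ends - 1)"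
      by (simp flip: of_nat_eq_enat of_nat_sum)
  qed
  then have "total_capacity T root \<chi> \<le> 1 + enat (card ends - 1) + (\<Sum>\<sigma>\<in>ends. path_capacity \<sigma> - 1)"
    unfolding total_capacity_def using L by (intro add_mono) auto
  also have "1 + enat (card ends - 1) = enat (card ends)"
    using \<open>0 < card ends\<close> by (simp add: one_enat_def)
  also have "enat (card ends) = (\<Sum>\<sigma>\<in>ends. 1)" by (simp add: of_nat_eq_enat)
  also have "(\<Sum>\<sigma>\<in>ends. 1) + (\<Sum>\<sigma>\<in>ends. path_capacity \<sigma> - 1) = (\<Sum>\<sigma>\<in>ends. path_capacity \<sigma>)"
    unfolding sum.distrib[symmetric]
  proof (rule sum.cong)
    show "1 + (path_capacity \<sigma> - 1) = path_capacity \<sigma>" if "\<sigma> \<in> ends" for \<sigma>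
      using path_capacity_ge_1[OF that] by (cases "path_capacity \<sigma>") (auto simp: one_enat_def)
  qed simp
  finally show False using cap assms by simp
qed

text \<open>There may be infinitely many candidates. Coordinate \<open>j\<close> counts the arcs
  shared with \<open>\<rho> j\<close>; these sets of shared arcs are nested, so a count that is not
  larger means an inclusion and a pairing that is not larger.\<close>

lemma exists_minimal_admissible:
  assumes "\<And>j. j < k \<Longrightarrow> \<rho> j \<in> ends" and "enat k < total_capacity T root \<chi>"
  shows "\<exists>\<sigma>. is_arg_min (\<lambda>\<sigma>. \<Sum>j<k. pairing l \<sigma> (\<rho> j)) (admissible T root \<chi> \<rho> k) \<sigma>"
proof -
  let ?S = "{\<sigma>. admissible T root \<chi> \<rho> k \<sigma>}"
  have "\<exists>\<sigma>\<in>?S. \<forall>\<tau>\<in>?S. (\<Sum>j<k. pairing l \<sigma> (\<rho> j)) \<le> (\<Sum>j<k. pairing l \<tau> (\<rho> j))"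
  proof (rule sum_monotone_coordinates_attains_min
      [where g = "\<lambda>j \<sigma>. card (path_arcs \<sigma> \<inter> path_arcs (\<rho> j))" and h = "\<lambda>j \<sigma>. pairing l \<sigma> (\<rho> j)"])
    show "finite {..<k}" by simp
    show "?S \<noteq> {}" using exists_admissible[OF assms(2)] by blast
    fix j \<sigma> \<tau>
    assume j: "j \<in> {..<k}" and \<sigma>: "\<sigma> \<in> ?S" and \<tau>: "\<tau> \<in> ?S"
      and le: "card (path_arcs \<sigma> \<inter> path_arcs (\<rho> j)) \<le> card (path_arcs \<tau> \<inter> path_arcs (\<rho> j))"
    have ends: "\<sigma> \<in> ends" "\<tau> \<in> ends" "\<rho> j \<in> ends" using \<sigma> \<tau> j assms(1) by (auto simp: admissible_iff)
    \<comment> \<open>An admissible infinite path was not chosen before, so it differs from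
      \<open>\<rho> j\<close>.\<close>
    have fin: "finite (path_arcs \<upsilon> \<inter> path_arcs (\<rho> j))" if "\<upsilon> \<in> ?S" for \<upsilon>
      using that j assms(1) by (intro finite_path_inter; cases \<upsilon>) (auto simp: admissible_def)
    have "path_arcs \<sigma> \<inter> path_arcs (\<rho> j) \<subseteq> path_arcs \<tau> \<inter> path_arcs (\<rho> j)"
    proof (rule ccontr)
      assume not: "\<not> ?thesis"
      then have "path_arcs \<tau> \<inter> path_arcs (\<rho> j) \<subseteq> path_arcs \<sigma> \<inter> path_arcs (\<rho> j)"
        using path_inter_comparable[OF ends(1,3,2)] by blast
      then show False using card_seteq[OF fin[OF \<sigma>]] le not by blast
    qed
    then show "pairing l \<sigma> (\<rho> j) \<le> pairing l \<tau> (\<rho> j)"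
      using pairing_mono[OF ends(2) fin[OF \<tau>]] by simp
  qed
  then show ?thesis by (auto simp: is_arg_min_linorder)
qed

lemma exists_greedy_choice:
  assumes "enat n < total_capacity T root \<chi>"
  shows "\<exists>\<rho>. greedy_choice T root l \<chi> n \<rho>"
proof -
  let ?m = "\<lambda>k \<rho>. is_arg_min (\<lambda>\<sigma>. \<Sum>j<k. pairing l \<sigma> (\<rho> j)) (admissible T root \<chi> \<rho> k)"
  have "\<exists>\<rho>. \<forall>j<k. ?m j \<rho> (\<rho> j)" if "k \<le> Suc n" for k
    using that
  proof (induction k)
    case (Suc k)
    then obtain \<rho> where \<rho>: "\<And>j. j < k \<Longrightarrow> ?m j \<rho> (\<rho> j)" by auto
    then have "\<rho> j \<in> ends" if "j < k" for j
      using that by (auto simp: is_arg_min_def admissible_iff)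
    moreover have "enat k < total_capacity T root \<chi>"
      using Suc.prems assms by (meson Suc_le_mono enat_ord_simps(1) order_le_less_trans)
    ultimately obtain \<sigma> where \<sigma>: "?m k \<rho> \<sigma>" using exists_minimal_admissible by blast
    \<comment> \<open>Step \<open>j\<close> depends only on entries before \<open>j\<close>, so a
      new entry at \<open>k\<close> affects no step up to and including \<open>k\<close>.\<close>
    have eq: "?m j (\<rho>(k := \<sigma>)) = ?m j \<rho>" if "j \<le> k" for j
    proof -
      have "{i. i < j \<and> (\<rho>(k := \<sigma>)) i = \<tau>} = {i. i < j \<and> \<rho> i = \<tau>}" for \<tau> using that by auto
      then have "admissible T root \<chi> (\<rho>(k := \<sigma>)) j = admissible T root \<chi> \<rho> j"
        by (intro ext) (simp only: admissible_iff)
      moreover have "(\<lambda>\<tau>. \<Sum>i<j. pairing l \<tau> ((\<rho>(k := \<sigma>)) i)) = (\<lambda>\<tau>. \<Sum>i<j. pairing l \<tau> (\<rho> i))"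
        using that by (intro ext sum.cong) auto
      ultimately show ?thesis by simp
    qed
    have "?m j (\<rho>(k := \<sigma>)) ((\<rho>(k := \<sigma>)) j)" if "j < Suc k" for j
      unfolding eq[OF that[unfolded less_Suc_eq_le]] using that \<rho>[of j] \<sigma> by (cases "j = k") auto
    then show ?case by blast
  qed simp
  from this[of "Suc n"] show ?thesis by (auto simp: greedy_choice_def less_Suc_eq_le)
qed

end

theorem proposition2p11:
  fixes T :: "('v, 'e) pre_digraph" and r :: 'v
    and l :: "'e \<Rightarrow> real" and \<chi> :: "'v \<Rightarrow> enat" and m n :: nat
  assumes "rooted_tree T r"
    and "locally_finite_digraph T"
    and "length_function T l"
    and "capacity_function T r \<chi>"
    and "m \<le> n"
    and "enat n < total_capacity T r \<chi>"
  shows "tree_factorial T r l \<chi> n \<ge> tree_factorial T r l \<chi> (n - m) + tree_factorial T r l \<chi> m"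
proof -
  interpret weighted_tree T r l \<chi>
    using assms by (simp add: weighted_tree_def weighted_tree_axioms_def)
  \<comment> \<open>Each of the three factorials is thus the value of actual choices, not an
    unspecified number.\<close>
  have "\<exists>\<rho>. greedy_choice T r l \<chi> k \<rho>" if "k \<le> n" for k
    using that assms(6) by (intro exists_greedy_choice) (meson enat_ord_simps(1) order_le_less_trans)
  then obtain \<rho> \<alpha> \<beta> where "greedy_choice T r l \<chi> n \<rho>"
    "greedy_choice T r l \<chi> (n - m) \<alpha>" "greedy_choice T r l \<chi> m \<beta>"
    using \<open>m \<le> n\<close> by (meson diff_le_self order_refl)
  then show ?thesis
    using greedy_choice_superadditive[of "n - m" m \<rho> \<alpha> \<beta>] \<open>m \<le> n\<close> by (simp add: tree_factorial_eq)
qed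

end
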